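(* Let $n$ be a natural number and let $P(w)=c_0+c_1w+c_2w^2+\dots+c_nw^n$, where $c_t\in\mathbb{C}$ for $t=0,1,\dots,n$. Let $A_1=z\frac{d}{dz}$, $A_2=e^{z}\frac{d}{dz}$, $A_3=\frac1z\frac{d}{dz}$. Then for every $\lambda\in\mathbb{C}$ the equalities $$P(A_1)z^{\lambda}=P(\lambda)z^{\lambda},\qquad P(A_2)e^{-\lambda e^{-z}}=P(\lambda)e^{-\lambda e^{-z}},\qquad P(A_3)e^{\frac12\lambda z^2}=P(\lambda)e^{\frac12\lambda z^2}$$ hold.
   Context: For a differential operator $A$ and a polynomial $P(w)=\sum_{t=0}^n c_tw^t$, $P(A)=\sum_{t=0}^n c_tA^t$, where $A^t$ is the $t$-fold composition of $A$ with itself and $A^0$ is the identity. The operators act on functions of the complex variable $z$; $z^\lambda$ denotes a holomorphic branch of the power function on a domain in $\mathbb{C}\setminus\{0\}$ on which one exists, and the third equality is understood for $z\neq0$. *)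

theory Defs
  imports "HOL-Complex_Analysis.Complex_Analysis" "HOL-Computational_Algebra.Polynomial"
begin

text \<open>
  Operators act on total functions. Since \<^const>\<open>deriv\<close> at a point depends only on the values of
  the function near that point, on an open set their action is independent of how a function
  is extended outside that set.
\<close>

type_synonym diff_op = "(complex \<Rightarrow> complex) \<Rightarrow> complex \<Rightarrow> complex"

definition poly_op :: "complex poly \<Rightarrow> diff_op \<Rightarrow> diff_op" where
  "poly_op P A f = (\<lambda>z. \<Sum>t\<le>degree P. coeff P t * (A ^^ t) f z)"

definition A1 :: diff_op where
  "A1 f = (\<lambda>z. z * deriv f z)"

definition A2 :: diff_op where
  "A2 f = (\<lambda>z. exp z * deriv f z)"

text \<open>At \<open>z = 0\<close> the value of the following operator is the meaningless \<open>1 / 0 = 0\<close>; it is only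
  to be used at \<open>z \<noteq> 0\<close>.\<close>

definition A3 :: diff_op where
  "A3 f = (\<lambda>z. (1 / z) * deriv f z)"

text \<open>
  A holomorphic branch of \<open>z\<^sup>\<lambda>\<close> on a domain \<open>D\<close> avoiding \<open>0\<close>: a holomorphic function which at each
  \<open>z\<close> takes one of the values \<open>exp (\<lambda> w)\<close>, where \<open>w\<close> is some logarithm of \<open>z\<close>. A holomorphic
  logarithm on all of \<open>D\<close> is not required, so that for instance integer powers have a branch on the
  whole punctured plane.
\<close>

definition power_branch :: "complex \<Rightarrow> complex set \<Rightarrow> (complex \<Rightarrow> complex) \<Rightarrow> bool" where
  "power_branch lam D g \<longleftrightarrow>
     open D \<and> connected D \<and> D \<noteq> {} \<and> 0 \<notin> D \<and> g holomorphic_on D \<and>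
     (\<forall>z\<in>D. \<exists>w. exp w = z \<and> g z = exp (lam * w))"

end

theory Submission
  imports Defs
begin

text \<open>
  Each operator has the form \<open>f \<mapsto> a f'\<close>, and each of the three functions is an eigenfunction with
  eigenvalue \<open>\<lambda>\<close>. Only the power function needs an argument: dividing a branch of \<open>z\<^sup>\<lambda>\<close> locally by
  \<open>exp (\<lambda> L)\<close> for a holomorphic logarithm \<open>L\<close> gives a continuous function with values in the
  countable set \<open>{exp (2 \<pi> i k \<lambda>) | k \<in> \<int>}\<close>, hence a constant.
\<close>

text \<open>Induction on \<open>t\<close>: since \<open>lam ^ t\<close> is a constant, applying
  \<open>A\<close> to \<open>lam ^ t * f\<close> only reproduces the eigenvalue equation of
  \<open>f\<close> and contributes one more factor \<open>lam\<close>. Openness of \<open>D\<close>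
  makes the induction hypothesis an identity near \<open>z\<close>, not just at \<open>z\<close>, so
  it may be differentiated.\<close>

lemma first_order_op_power_eigenfunction:
  fixes a f :: "complex \<Rightarrow> complex"
  assumes op: "\<And>h. A h = (\<lambda>z. a z * deriv h z)"
    and D: "open D" and hol: "f holomorphic_on D"
    and eig: "\<And>z. z \<in> D \<Longrightarrow> a z * deriv f z = lam * f z"
    and "z \<in> D"
  shows "(A ^^ t) f z = lam ^ t * f z"
  using \<open>z \<in> D\<close>
proof (induction t arbitrary: z)
  case (Suc t)
  have "eventually (\<lambda>w. (A ^^ t) f w = lam ^ t * f w) (nhds z)"
    using eventually_nhds_in_open[OF D Suc.prems] Suc.IH by (auto elim: eventually_mono)
  then have "deriv ((A ^^ t) f) z = deriv (\<lambda>w. lam ^ t * f w) z"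
    by (rule deriv_cong_ev) simp
  also have "\<dots> = lam ^ t * deriv f z"
    using hol D Suc.prems by (simp add: holomorphic_on_imp_differentiable_at)
  finally show ?case
    using eig[OF Suc.prems] by (simp add: op[of "(A ^^ t) f"] mult.left_commute)
qed simp

lemma poly_op_eigenfunction:
  fixes a f :: "complex \<Rightarrow> complex"
  assumes "\<And>h. A h = (\<lambda>z. a z * deriv h z)"
    and "open D" and "f holomorphic_on D"
    and "\<And>z. z \<in> D \<Longrightarrow> a z * deriv f z = lam * f z"
    and "z \<in> D"
  shows "poly_op P A f z = poly P lam * f z"
  using first_order_op_power_eigenfunction[OF assms]
  by (simp add: poly_op_def poly_altdef sum_distrib_right mult.assoc)

text \<open>Any two logarithms of a nonzero \<open>z\<close> differ by an integer multiple of 2 pi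
  i, so the integers index all values of the power. For \<open>z = 0\<close> there are no logarithms
  and the set is empty.\<close>

lemma countable_exp_logarithms: "countable {exp (lam * w) | w::complex. exp w = z}"
proof (cases "z = 0")
  case False
  then have "\<exists>k::int. w = Ln z + of_int (2 * k) * pi * \<i>" if "exp w = z" for w
    using that exp_eq[of w "Ln z"] by simp
  then have "{exp (lam * w) | w. exp w = z}
          \<subseteq> (\<lambda>w. exp (lam * w)) ` range (\<lambda>k::int. Ln z + of_int (2 * k) * pi * \<i>)"
    by fast
  then show ?thesis
    by (rule countable_subset) simp
qed simp

text \<open>The image is connected, and a connected subset of a metric space with two distinct
  points is uncountable.\<close>

lemma continuous_on_connected_countable_range_constant:
  fixes h :: "'a::topological_space \<Rightarrow> 'b::metric_space"
  assumes "connected S" "continuous_on S h" "countable (h ` S)" "x \<in> S" "y \<in> S"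
  shows "h x = h y"
  using assms connected_uncountable[of "h ` S" "h x" "h y"] connected_continuous_image by blast

text \<open>\<open>D\<close> itself may carry no holomorphic logarithm, but the claim is local: a
  ball around \<open>z0\<close> inside \<open>D\<close> is contractible and avoids 0, so a logarithm
  \<open>L\<close> exists there.\<close>

lemma power_branch_deriv:
  assumes g: "power_branch lam D g" and z0: "z0 \<in> D"
  shows "z0 * deriv g z0 = lam * g z0"
proof -
  have D: "open D" "0 \<notin> D" and hol: "g holomorphic_on D"
    and val: "\<And>z. z \<in> D \<Longrightarrow> \<exists>w. exp w = z \<and> g z = exp (lam * w)"
    using g by (auto simp: power_branch_def)
  obtain r where r: "r > 0" "ball z0 r \<subseteq> D"
    using D z0 open_contains_ball by blast
  let ?B = "ball z0 r"
  have "(\<lambda>z. z) holomorphic_on ?B" "\<And>z. z \<in> ?B \<Longrightarrow> z \<noteq> 0"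
    using r D by (blast intro: holomorphic_on_ident)+
  then obtain L where L: "L holomorphic_on ?B" "\<And>z. z \<in> ?B \<Longrightarrow> z = exp (L z)"
    using contractible_imp_holomorphic_log convex_imp_contractible[OF convex_ball] by metis
  define h where "h = (\<lambda>z. g z * exp (- lam * L z))"
  have gh: "g z = h z * exp (lam * L z)" for z
    by (simp add: h_def mult.assoc flip: exp_add)
  have holB: "g holomorphic_on ?B"
    using hol r holomorphic_on_subset by blast
  \<comment> \<open>Both \<open>L z\<close> and the \<open>w\<close> witnessing the value of
    \<open>g\<close> are logarithms of \<open>z\<close>, so their difference is a logarithm of 1.
    The resulting countable set no longer depends on \<open>z\<close>.\<close>
  have "h z \<in> {exp (lam * w) | w. exp w = 1}" if z: "z \<in> ?B" for z
  proof -
    obtain w where w: "exp w = z" "g z = exp (lam * w)"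
      using val z r by blast
    have "exp (w - L z) = 1"
      using w L(2)[OF z] by (metis exp_diff div_self exp_not_eq_zero)
    moreover have "h z = exp (lam * (w - L z))"
      by (simp add: h_def w ring_distribs exp_diff exp_minus field_simps)
    ultimately show ?thesis by blast
  qed
  then have "countable (h ` ?B)"
    by (intro countable_subset[OF _ countable_exp_logarithms[of lam 1]]) blast
  moreover have "continuous_on ?B h"
    unfolding h_def
    by (intro holomorphic_on_imp_continuous_on holomorphic_intros holB L)
  ultimately have "h z = h z0" if "z \<in> ?B" for z
    using that r by (intro continuous_on_connected_countable_range_constant[of ?B]) auto
  then have g_eq: "g z = h z0 * exp (lam * L z)" if "z \<in> ?B" for z
    using gh[of z] that by metis
  have dL: "(L has_field_derivative deriv L z0) (at z0)"
    using L r by (intro holomorphic_derivI[of _ ?B]) auto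
  \<comment> \<open>Differentiating \<open>exp (L z) = z\<close> at \<open>z0\<close> yields that
    \<open>deriv L z0\<close> is the reciprocal of \<open>z0\<close>.\<close>
  have "((\<lambda>z. exp (L z)) has_field_derivative exp (L z0) * deriv L z0) (at z0)"
    by (rule derivative_eq_intros dL refl)+
  then have "((\<lambda>z. z) has_field_derivative exp (L z0) * deriv L z0) (at z0)"
    by (rule has_field_derivative_transform_within_open[of _ _ _ ?B]) (use L r in auto)
  then have L1: "z0 * deriv L z0 = 1"
    using L(2)[of z0] r DERIV_unique[OF _ DERIV_ident] by force
  have "((\<lambda>z. h z0 * exp (lam * L z)) has_field_derivative
          h z0 * (exp (lam * L z0) * (lam * deriv L z0))) (at z0)"
    by (rule derivative_eq_intros dL refl)+ simp
  then have "(g has_field_derivative h z0 * (exp (lam * L z0) * (lam * deriv L z0))) (at z0)"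
    by (rule has_field_derivative_transform_within_open[of _ _ _ ?B]) (use g_eq r in auto)
  then have "deriv g z0 = g z0 * lam * deriv L z0"
    by (simp add: DERIV_imp_deriv gh[of z0])
  then show ?thesis
    using L1 by (metis mult.assoc mult.commute mult.right_neutral)
qed

theorem theorem1p1:
  fixes n :: nat and c :: "nat \<Rightarrow> complex" and P :: "complex poly" and lam :: complex
  assumes "P = (\<Sum>t\<le>n. monom (c t) t)"
  shows "(\<forall>D g. power_branch lam D g \<longrightarrow>
            (\<forall>z\<in>D. poly_op P A1 g z = poly P lam * g z)) \<and>
         (\<forall>z. poly_op P A2 (\<lambda>z. exp (- lam * exp (- z))) z
                = poly P lam * exp (- lam * exp (- z))) \<and>
         (\<forall>z. z \<noteq> 0 \<longrightarrow>
            poly_op P A3 (\<lambda>z. exp (1 / 2 * lam * z ^ 2)) z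
                = poly P lam * exp (1 / 2 * lam * z ^ 2))"
proof (intro conjI allI impI ballI)
  fix D g z
  assume g: "power_branch lam D g" and z: "z \<in> D"
  show "poly_op P A1 g z = poly P lam * g z"
  proof (rule poly_op_eigenfunction[OF A1_def _ _ power_branch_deriv[OF g] z])
    show "open D" "g holomorphic_on D"
      using g by (auto simp: power_branch_def)
  qed
next
  fix z :: complex
  let ?f = "\<lambda>z. exp (- lam * exp (- z))"
  have "exp z * deriv ?f z = lam * ?f z" for z
  proof -
    have "(?f has_field_derivative ?f z * (lam * exp (- z))) (at z)"
      by (rule derivative_eq_intros refl)+ simp
    then show ?thesis
      by (simp add: DERIV_imp_deriv exp_minus)
  qed
  then show "poly_op P A2 ?f z = poly P lam * ?f z"
    by (intro poly_op_eigenfunction[OF A2_def open_UNIV]) (auto intro!: holomorphic_intros)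
next
  fix z :: complex
  assume z: "z \<noteq> 0"
  let ?f = "\<lambda>z. exp (1 / 2 * lam * z ^ 2)"
  \<comment> \<open>At 0 the left side would be 0 by the convention \<open>1 / 0 = 0\<close>, while
    the right side is \<open>lam\<close>; hence the open set used here is the punctured
    plane.\<close>
  have "1 / z * deriv ?f z = lam * ?f z" if "z \<in> - {0}" for z
  proof -
    have "(?f has_field_derivative ?f z * (lam * z)) (at z)"
      by (rule derivative_eq_intros refl)+ simp
    then show ?thesis
      using that by (simp add: DERIV_imp_deriv)
  qed
  with z show "poly_op P A3 ?f z = poly P lam * ?f z"
    by (intro poly_op_eigenfunction[OF A3_def, of "- {0}"]) (auto intro!: holomorphic_intros)
qed

end
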